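(* Let $a<b$, $0<\alpha<1$, and let $f\in H^1(a,b)$ attain its minimum over $[a,b]$ at a point $t_0\in[a,b]$. Then $$({}^{ABC}{}_{a}D^\alpha f)(t_0)\ \le\ \frac{B(\alpha)}{1-\alpha}\,E_\alpha\!\left[-\frac{\alpha}{1-\alpha}(t_0-a)^\alpha\right]\bigl(f(t_0)-f(a)\bigr)\ \le\ 0.$$
   Context: All functions are real-valued; a function in the Sobolev space $H^1(a,b)$ is identified with its continuous representative on $[a,b]$. $E_\alpha(z)=\sum_{k\ge 0} z^k/\Gamma(\alpha k+1)$ is the Mittag-Leffler function, and $B$ is a normalization function with $B(\alpha)>0$ and $B(0)=B(1)=1$. For $f\in H^1(a,b)$ and $\alpha\in(0,1)$, the left Caputo fractional derivative with Mittag-Leffler non-singular kernel is $$({}^{ABC}{}_{a}D^\alpha f)(t)=\frac{B(\alpha)}{1-\alpha}\int_a^t E_\alpha\!\left[-\frac{\alpha}{1-\alpha}(t-s)^\alpha\right] f'(s)\,ds,\qquad t\in[a,b].$$ *)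

theory Defs
  imports "HOL-Analysis.Analysis"
begin

text \<open>The space \<open>C\<^sub>c\<^sup>\<infinity>(a,b)\<close>; members are extended by zero to the whole line.\<close>

definition test_functions :: "real \<Rightarrow> real \<Rightarrow> (real \<Rightarrow> real) set" where
  "test_functions a b =
     {\<phi>. (\<forall>n x. (deriv ^^ n) \<phi> field_differentiable at x) \<and>
         (\<exists>K. compact K \<and> K \<subseteq> {a<..<b} \<and> (\<forall>x. x \<notin> K \<longrightarrow> \<phi> x = 0))}"

definition locally_integrable :: "real \<Rightarrow> real \<Rightarrow> (real \<Rightarrow> real) \<Rightarrow> bool" where
  "locally_integrable a b f \<longleftrightarrow>
     (\<forall>K. compact K \<and> K \<subseteq> {a<..<b} \<longrightarrow> f absolutely_integrable_on K)"

definition has_weak_derivative ::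
    "(real \<Rightarrow> real) \<Rightarrow> (real \<Rightarrow> real) \<Rightarrow> real \<Rightarrow> real \<Rightarrow> bool" where
  "has_weak_derivative f g a b \<longleftrightarrow>
     locally_integrable a b f \<and> locally_integrable a b g \<and>
     (\<forall>\<phi>\<in>test_functions a b.
        (LINT x:{a<..<b}|lebesgue. f x * deriv \<phi> x) =
        - (LINT x:{a<..<b}|lebesgue. g x * \<phi> x))"

definition square_integrable :: "real \<Rightarrow> real \<Rightarrow> (real \<Rightarrow> real) \<Rightarrow> bool" where
  "square_integrable a b f \<longleftrightarrow>
     set_borel_measurable lebesgue {a<..<b} f \<and>
     (\<lambda>x. (f x)\<^sup>2) absolutely_integrable_on {a<..<b}"

text \<open>Functions on the line whose restriction to \<open>(a,b)\<close> represents an element of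
  \<open>H\<^sup>1(a,b)\<close>; the continuous representative is singled out by additionally requiring
  \<^term>\<open>continuous_on {a..b} f\<close>.\<close>

definition H1 :: "real \<Rightarrow> real \<Rightarrow> (real \<Rightarrow> real) set" where
  "H1 a b = {f. square_integrable a b f \<and>
                (\<exists>g. has_weak_derivative f g a b \<and> square_integrable a b g)}"

text \<open>The weak derivative is unique only up to null sets; an arbitrary representative is
  chosen, which does not affect integrals.\<close>

definition weak_deriv :: "real \<Rightarrow> real \<Rightarrow> (real \<Rightarrow> real) \<Rightarrow> real \<Rightarrow> real" where
  "weak_deriv a b f = (SOME g. has_weak_derivative f g a b)"

definition mittag_leffler :: "real \<Rightarrow> real \<Rightarrow> real" where
  "mittag_leffler \<alpha> z = (\<Sum>k. z ^ k / Gamma (\<alpha> * real k + 1))"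

text \<open>The right endpoint \<open>b\<close> enters only through the interval on which the weak derivative
  is taken.\<close>

definition ABC_deriv ::
    "(real \<Rightarrow> real) \<Rightarrow> real \<Rightarrow> real \<Rightarrow> real \<Rightarrow> (real \<Rightarrow> real) \<Rightarrow> real \<Rightarrow> real" where
  "ABC_deriv B \<alpha> a b f t =
     B \<alpha> / (1 - \<alpha>) *
     (LINT s:{a..t}|lebesgue.
        mittag_leffler \<alpha> (- (\<alpha> / (1 - \<alpha>)) * (t - s) powr \<alpha>) * weak_deriv a b f s)"

end

theory Submission
  imports Defs "HOL-Real_Asymp.Real_Asymp"
begin

text \<open>The kernel \<open>k s = E\<^sub>\<alpha>(-\<lambda> (t\<^sub>0 - s) powr \<alpha>)\<close> is nonnegative and increasing in \<open>s\<close>. By the second mean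
  value theorem the integral of \<open>k * f'\<close> over \<open>[a, t\<^sub>0]\<close> is \<open>k a * (f c - f a) + k t\<^sub>0 * (f t\<^sub>0 - f c)\<close> for
  some \<open>c\<close>, and since \<open>f t\<^sub>0 \<le> f c\<close> replacing \<open>k t\<^sub>0\<close> by the smaller \<open>k a\<close> increases this to
  \<open>k a * (f t\<^sub>0 - f a)\<close>.

  Positivity and monotonicity of \<open>E\<^sub>\<alpha>(-x)\<close> come from a discretization of the fractional relaxation
  equation: \<open>E\<^sub>\<alpha>(-x)\<close> is the limit of the \<open>n\<close>-th Taylor coefficient of
  \<open>(1 - z) powr (\<alpha> - 1) / ((1 - z) powr \<alpha> + \<mu>)\<close> with \<open>\<mu> = x / n powr \<alpha>\<close>. All coefficients of \<open>(1 - z) powr \<alpha>\<close>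
  but the constant one are nonpositive, so the quotient satisfies a recurrence with nonnegative
  weights, from which its coefficients are nonnegative and decreasing in \<open>\<mu>\<close>.\<close>

section \<open>The Mittag-Leffler function on the negative half-line\<close>

text \<open>The coefficient of \<open>z\<^sup>n\<close> in \<open>(1 - z) powr (-s)\<close>.\<close>

definition rising_coeff :: "real \<Rightarrow> nat \<Rightarrow> real" where
  "rising_coeff s n = pochhammer s n / fact n"

lemma rising_coeff_0 [simp]: "rising_coeff s 0 = 1"
  by (simp add: rising_coeff_def)

text \<open>Vandermonde convolution: the coefficient form of \<open>(1 - z) powr (-s) * (1 - z) powr
  (-t) = (1 - z) powr (-(s + t))\<close>.\<close>

lemma rising_coeff_add: "rising_coeff (s + t) n = (\<Sum>j\<le>n. rising_coeff s j * rising_coeff t (n - j))"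
  unfolding rising_coeff_def pochhammer_binomial_sum
  by (auto simp: sum_divide_distrib binomial_fact field_simps intro!: sum.cong)

lemma rising_coeff_nonneg: "0 \<le> s \<Longrightarrow> 0 \<le> rising_coeff s n"
  unfolding rising_coeff_def pochhammer_prod by (intro divide_nonneg_nonneg prod_nonneg) auto

text \<open>Only the leading Pochhammer factor \<open>- \<alpha>\<close> is nonpositive; the others,
  \<open>1 - \<alpha>\<close>, \<open>2 - \<alpha>\<close> and so on, are nonnegative. This sign
  makes the weights of the later recurrence nonnegative.\<close>

lemma rising_coeff_nonpos:
  assumes "0 \<le> \<alpha>" "\<alpha> \<le> 1" "0 < n"
  shows "rising_coeff (- \<alpha>) n \<le> 0"
proof -
  obtain m where n: "n = Suc m" using assms(3) gr0_implies_Suc by blast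
  have "0 \<le> pochhammer (1 - \<alpha>) m"
    unfolding pochhammer_prod using assms by (intro prod_nonneg) auto
  then show ?thesis
    unfolding rising_coeff_def n pochhammer_rec
    using assms(1) by (simp add: divide_nonpos_pos mult_nonneg_nonneg)
qed

lemma rising_coeff_prod: "rising_coeff (s + 1) n = (\<Prod>j=1..n. 1 + s / real j)"
  unfolding rising_coeff_def
proof (induction n)
  case (Suc n)
  have "pochhammer (s+1) (Suc n) / fact (Suc n) = pochhammer (s+1) n / fact n * ((s + 1 + real n) / real (Suc n))"
    by (simp add: pochhammer_rec' divide_simps)
  also have "(s + 1 + real n) / real (Suc n) = 1 + s / real (Suc n)"
    by (simp add: divide_simps)
  finally show ?case using Suc by simp
qed simp

text \<open>Since the harmonic numbers diverge, a large \<open>m\<close> makes the exponential factor beat any geometric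
  growth in \<open>s\<close>; \<open>m = 0\<close> would only do so for small arguments of the Mittag-Leffler function.\<close>

lemma rising_coeff_bound:
  assumes "0 \<le> s" "m \<le> n" "0 < n"
  shows "rising_coeff (s + 1) n \<le> (1 + s) ^ m * exp (s * (1 - harm m)) * real n powr s"
proof -
  have "rising_coeff (s + 1) n = (\<Prod>j=1..m. 1 + s / real j) * (\<Prod>j=m+1..n. 1 + s / real j)"
    unfolding rising_coeff_prod using assms(2) prod.ub_add_nat [of 1 m "\<lambda>j. 1 + s / real j" "n - m"] by simp
  \<comment> \<open>The first \<open>m\<close> factors are bounded crudely; in the tail,
    \<open>1 + x \<le> exp x\<close> turns the product into a difference of harmonic
    numbers.\<close>
  also have "\<dots> \<le> (\<Prod>j=1..m. 1 + s) * (\<Prod>j=m+1..n. exp (s / real j))"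
  proof (intro mult_mono prod_mono conjI)
    fix j assume "j \<in> {1..m}"
    then have "s * 1 \<le> s * real j" using assms(1) by (intro mult_left_mono) auto
    then show "1 + s / real j \<le> 1 + s" using \<open>j \<in> {1..m}\<close> by (simp add: field_simps)
  qed (use assms(1) in \<open>auto intro!: prod_nonneg exp_ge_add_one_self\<close>)
  also have "(\<Prod>j=m+1..n. exp (s / real j)) = exp (s * (harm n - harm m))"
  proof -
    have "harm n = harm m + (\<Sum>j=m+1..n. inverse (real j))"
      unfolding harm_def using assms(2) sum.ub_add_nat [of 1 m "\<lambda>j. inverse (real j)" "n - m"] by simp
    then show ?thesis
      by (simp add: exp_sum [symmetric] sum_distrib_left divide_inverse)
  qed
  also have "(\<Prod>j=1..m. 1 + s) * exp (s * (harm n - harm m))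
      \<le> (1 + s) ^ m * exp (s * (1 + ln (real n) - harm m))"
  proof -
    \<comment> \<open>\<open>harm n - ln n\<close> is decreasing and equals 1 at
      \<open>n = 1\<close>.\<close>
    have "harm n \<le> 1 + ln (real n)"
      using euler_mascheroni_sequence_decreasing[of 1 n] assms(3) by (simp add: harm_expand)
    then show ?thesis using assms(1) by (auto intro!: mult_left_mono)
  qed
  also have "\<dots> = (1 + s) ^ m * exp (s * (1 - harm m)) * real n powr s"
    using assms(3) by (simp add: powr_def algebra_simps exp_add [symmetric])
  finally show ?thesis .
qed

lemma summable_poly_geometric:
  fixes q \<alpha> :: real
  assumes "0 \<le> \<alpha>" "0 \<le> q" "q < 1"
  shows "summable (\<lambda>k. (1 + \<alpha> * real k) ^ m * q ^ k)"
proof (cases "q = 0")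
  case True
  then show ?thesis by (intro summable_finite[of "{0}"]) auto
next
  case False
  with assms have q: "0 < q" "0 < - ln q" by auto
  define c where "c = - ln q"
  \<comment> \<open>With \<open>q ^ k\<close> written as an exponential of rate
    \<open>c > 0\<close>, any polynomial factor is beaten, and comparison with
    \<open>1 / k ^ 2\<close> suffices.\<close>
  have "(\<lambda>k::nat. (1 + \<alpha> * real k) ^ m * exp (- c * real k)) \<in> O(\<lambda>k. 1 / real k ^ 2)"
    using q(2) assms(1) unfolding c_def[symmetric] by (cases "\<alpha> = 0") (simp, real_asymp, real_asymp)
  moreover have "exp (- c * real k) = q ^ k" for k
    using q exp_of_nat_mult[of k "ln q"] by (simp add: c_def mult.commute)
  moreover have "summable (\<lambda>k. norm (1 / real k ^ 2))"
    using inverse_power_summable[of 2, where ?'a = real] by (simp add: inverse_eq_divide)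
  ultimately show ?thesis
    by (simp only: summable_comparison_test_bigo)
qed

text \<open>Euler's limit formula for \<open>1 / Gamma\<close>. \<open>rGamma_series\<close> has one
  more Pochhammer factor and one more power of \<open>n\<close>; the ratio
  \<open>n / (s + 1 + n)\<close>, which tends to 1, corrects for both.\<close>

lemma rising_coeff_limit:
  assumes "0 \<le> s"
  shows "(\<lambda>n. rising_coeff (s + 1) n / real n powr s) \<longlonglongrightarrow> 1 / Gamma (s + 1)"
proof -
  have "(\<lambda>n. rGamma_series (s + 1) n * (real n / (s + 1 + real n))) \<longlonglongrightarrow> rGamma (s + 1) * 1"
  proof (intro tendsto_mult rGamma_series_LIMSEQ)
    show "(\<lambda>n. real n / (s + 1 + real n)) \<longlonglongrightarrow> 1" by real_asymp
  qed
  moreover have "\<forall>\<^sub>F n in sequentially. rGamma_series (s + 1) n * (real n / (s + 1 + real n))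
      = rising_coeff (s + 1) n / real n powr s"
    using eventually_gt_at_top[of 0]
  proof eventually_elim
    case (elim n)
    have pos: "s + 1 + real n > 0" using assms by linarith
    have "exp ((s + 1) * ln (real n)) = real n powr s * real n"
      using elim by (simp add: powr_def ring_distribs exp_add)
    then have "rGamma_series (s + 1) n
        = pochhammer (s + 1) n * (s + 1 + real n) / (fact n * (real n powr s * real n))"
      by (simp add: rGamma_series_def pochhammer_rec' mult.commute)
    then show ?case using elim pos by (simp add: rising_coeff_def)
  qed
  ultimately show ?thesis
    by (simp add: rGamma_inverse_Gamma inverse_eq_divide tendsto_cong)
qed


text \<open>The coefficient of \<open>z\<^sup>n\<close> in \<open>(1 - z) powr (\<alpha> - 1) / ((1 - z) powr \<alpha> + \<mu>)\<close>, expanded in powers of \<open>\<mu>\<close>;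
  the series converges only for \<open>\<bar>\<mu>\<bar> < 1\<close>.\<close>

definition ml_approx :: "real \<Rightarrow> real \<Rightarrow> nat \<Rightarrow> real" where
  "ml_approx \<alpha> \<mu> n = (\<Sum>k. (- \<mu>) ^ k * rising_coeff (\<alpha> * real k + 1) n)"

text \<open>For fixed \<open>n\<close> each of the \<open>n\<close> factors of the coefficient is at
  most \<open>1 + \<alpha> * k\<close>, so the growth in \<open>k\<close> is polynomial and
  \<open>\<mu> ^ k\<close> wins.\<close>

lemma summable_ml_approx:
  assumes "0 \<le> \<alpha>" "0 \<le> \<mu>" "\<mu> < 1"
  shows "summable (\<lambda>k. (- \<mu>) ^ k * rising_coeff (\<alpha> * real k + 1) n)"
proof (rule summable_comparison_test)
  show "summable (\<lambda>k. (1 + \<alpha> * real k) ^ n * \<mu> ^ k)"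
    using assms by (rule summable_poly_geometric)
  have "rising_coeff (\<alpha> * real k + 1) n \<le> (1 + \<alpha> * real k) ^ n" for k
  proof -
    have "(\<Prod>j=1..n. 1 + \<alpha> * real k / real j) \<le> (\<Prod>j=1..n. 1 + \<alpha> * real k)"
    proof (intro prod_mono conjI)
      fix j assume j: "j \<in> {1..n}"
      then have "\<alpha> * real k * 1 \<le> \<alpha> * real k * real j"
        using assms(1) by (intro mult_left_mono) auto
      then show "1 + \<alpha> * real k / real j \<le> 1 + \<alpha> * real k"
        using j by (simp add: field_simps)
    qed (use assms(1) in auto)
    then show ?thesis by (simp add: rising_coeff_prod)
  qed
  then show "\<exists>N. \<forall>k\<ge>N. norm ((- \<mu>) ^ k * rising_coeff (\<alpha> * real k + 1) n)
      \<le> (1 + \<alpha> * real k) ^ n * \<mu> ^ k"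
    using assms by (auto simp: abs_mult power_abs rising_coeff_nonneg mult.commute intro!: mult_left_mono)
qed

text \<open>Multiplying the generating function by \<open>(1 - z) powr \<alpha> + \<mu>\<close>
  leaves \<open>(1 - z) powr (\<alpha> - 1)\<close>. Comparing coefficients and keeping only the
  term \<open>j = 0\<close>, of weight 1, on the left gives the recurrence.\<close>

lemma ml_approx_rec:
  assumes "0 \<le> \<alpha>" "0 \<le> \<mu>" "\<mu> < 1"
  shows "(1 + \<mu>) * ml_approx \<alpha> \<mu> n =
    rising_coeff (1 - \<alpha>) n + (\<Sum>j=1..n. - rising_coeff (- \<alpha>) j * ml_approx \<alpha> \<mu> (n - j))"
proof -
  let ?t = "\<lambda>n k. (- \<mu>) ^ k * rising_coeff (\<alpha> * real k + 1) n"
  have sm: "summable (?t n)" for n using assms by (rule summable_ml_approx)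
  have "(\<Sum>j\<le>n. rising_coeff (- \<alpha>) j * ml_approx \<alpha> \<mu> (n - j))
      = (\<Sum>k. \<Sum>j\<le>n. rising_coeff (- \<alpha>) j * ?t (n - j) k)"
    unfolding ml_approx_def
    by (simp add: suminf_sum summable_mult sm suminf_mult)
  also have "\<dots> = (\<Sum>k. (- \<mu>) ^ k * rising_coeff (\<alpha> * real k + 1 - \<alpha>) n)"
  proof (rule suminf_cong)
    fix k
    show "(\<Sum>j\<le>n. rising_coeff (- \<alpha>) j * ?t (n - j) k) = (- \<mu>) ^ k * rising_coeff (\<alpha> * real k + 1 - \<alpha>) n"
      using rising_coeff_add[of "- \<alpha>" "\<alpha> * real k + 1" n]
      by (simp add: sum_distrib_left mult_ac)
  qed
  \<comment> \<open>The convolution has lowered the argument by \<open>\<alpha>\<close>, so term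
    \<open>k + 1\<close> is \<open>- \<mu>\<close> times term \<open>k\<close> of the original
    series; the term \<open>k = 0\<close> is the source.\<close>
  also have "\<dots> = rising_coeff (1 - \<alpha>) n + (\<Sum>k. - \<mu> * ?t n k)"
  proof -
    have eq: "(- \<mu>) ^ Suc k * rising_coeff (\<alpha> * real (Suc k) + 1 - \<alpha>) n = - \<mu> * ?t n k" for k
      by (simp add: algebra_simps)
    have "summable (\<lambda>k. (- \<mu>) ^ Suc k * rising_coeff (\<alpha> * real (Suc k) + 1 - \<alpha>) n)"
      unfolding eq by (intro summable_mult sm)
    then have "summable (\<lambda>k. (- \<mu>) ^ k * rising_coeff (\<alpha> * real k + 1 - \<alpha>) n)"
      by (subst (asm) summable_Suc_iff)
    from suminf_split_head[OF this, unfolded eq] show ?thesis by simp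
  qed
  also have "(\<Sum>k. - \<mu> * ?t n k) = - \<mu> * ml_approx \<alpha> \<mu> n"
    unfolding ml_approx_def by (rule suminf_mult[OF sm])
  finally have "(\<Sum>j\<le>n. rising_coeff (- \<alpha>) j * ml_approx \<alpha> \<mu> (n - j))
    = rising_coeff (1 - \<alpha>) n - \<mu> * ml_approx \<alpha> \<mu> n" by simp
  moreover have "(\<Sum>j\<le>n. rising_coeff (- \<alpha>) j * ml_approx \<alpha> \<mu> (n - j))
    = ml_approx \<alpha> \<mu> n + (\<Sum>j=1..n. rising_coeff (- \<alpha>) j * ml_approx \<alpha> \<mu> (n - j))"
    by (simp add: atMost_atLeast0 sum.atLeast_Suc_atMost)
  ultimately show ?thesis by (simp add: sum_negf algebra_simps)
qed

lemma ml_approx_nonneg: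
  assumes "0 \<le> \<alpha>" "\<alpha> \<le> 1" "0 \<le> \<mu>" "\<mu> < 1"
  shows "0 \<le> ml_approx \<alpha> \<mu> n"
proof (induction n rule: less_induct)
  case (less n)
  have "0 \<le> (1 + \<mu>) * ml_approx \<alpha> \<mu> n"
    unfolding ml_approx_rec[OF assms(1,3,4)]
    using assms less by (auto intro!: add_nonneg_nonneg rising_coeff_nonneg sum_nonneg mult_nonneg_nonneg rising_coeff_nonpos mult_nonpos_nonneg)
  then show ?case using assms(3) by (simp add: zero_le_mult_iff)
qed

text \<open>Strong induction comparing the recurrences for \<open>\<mu>\<close> and
  \<open>\<nu>\<close>: source and weights agree, and only the factor on the left differs.
  Nonnegativity allows that factor to be changed.\<close>

lemma ml_approx_antimono:
  assumes "0 \<le> \<alpha>" "\<alpha> \<le> 1" "0 \<le> \<mu>" "\<mu> \<le> \<nu>" "\<nu> < 1"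
  shows "ml_approx \<alpha> \<nu> n \<le> ml_approx \<alpha> \<mu> n"
proof (induction n rule: less_induct)
  case (less n)
  let ?c = "\<lambda>j. - rising_coeff (- \<alpha>) j"
  have "(1 + \<mu>) * ml_approx \<alpha> \<nu> n \<le> (1 + \<nu>) * ml_approx \<alpha> \<nu> n"
    using assms ml_approx_nonneg[of \<alpha> \<nu> n] by (intro mult_right_mono) auto
  also have "\<dots> = rising_coeff (1 - \<alpha>) n + (\<Sum>j=1..n. ?c j * ml_approx \<alpha> \<nu> (n - j))"
    using assms by (intro ml_approx_rec) auto
  also have "\<dots> \<le> rising_coeff (1 - \<alpha>) n + (\<Sum>j=1..n. ?c j * ml_approx \<alpha> \<mu> (n - j))"
    using assms less by (intro add_left_mono sum_mono mult_left_mono) (auto intro: rising_coeff_nonpos)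
  also have "\<dots> = (1 + \<mu>) * ml_approx \<alpha> \<mu> n"
    using assms by (intro ml_approx_rec [symmetric]) auto
  finally show ?case using assms(3) by simp
qed

text \<open>Each term converges by the limit formula for \<open>1 / Gamma\<close>; Tannery's
  theorem, dominated convergence for series, exchanges limit and sum.\<close>

lemma ml_approx_limit:
  assumes "0 < \<alpha>" "0 \<le> x"
  shows "(\<lambda>n. ml_approx \<alpha> (x / real n powr \<alpha>) n) \<longlonglongrightarrow> mittag_leffler \<alpha> (- x)"
proof -
  \<comment> \<open>This fixes an \<open>m\<close> for which the ratio \<open>q\<close> of the
    majorant is below 1, however large \<open>x\<close> is.\<close>
  have "((\<lambda>m. x * exp (\<alpha> * (1 - harm m))) \<longlongrightarrow> 0) sequentially"
  proof -
    have "filterlim (\<lambda>m. \<alpha> * (harm m - 1)) at_top sequentially"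
      using assms(1) filterlim_tendsto_add_at_top[OF tendsto_const harm_at_top, of "- 1 :: real"]
      by (intro filterlim_tendsto_pos_mult_at_top[OF tendsto_const]) auto
    then have "filterlim (\<lambda>m. - (\<alpha> * (harm m - 1))) at_bot sequentially"
      by (simp add: filterlim_uminus_at_bot)
    then have "((\<lambda>m. exp (- (\<alpha> * (harm m - 1)))) \<longlongrightarrow> 0) sequentially"
      by (rule filterlim_compose[OF exp_at_bot])
    from tendsto_mult_left[OF this, of x] show ?thesis by (simp add: algebra_simps)
  qed
  then have "\<forall>\<^sub>F m in sequentially. x * exp (\<alpha> * (1 - harm m)) < 1"
    by (rule order_tendstoD) simp
  then obtain m where m: "x * exp (\<alpha> * (1 - harm m)) < 1"
    using eventually_happens' trivial_limit_sequentially by blast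
  define q where "q = x * exp (\<alpha> * (1 - harm m))"
  let ?a = "\<lambda>k n. (- (x / real n powr \<alpha>)) ^ k * rising_coeff (\<alpha> * real k + 1) n"
  have pw: "real n powr (\<alpha> * real k) = (real n powr \<alpha>) ^ k" if "0 < n" for n k
    using that by (simp add: powr_realpow flip: powr_powr)
  have "(\<lambda>n. ?a k n) \<longlonglongrightarrow> (- x) ^ k / Gamma (\<alpha> * real k + 1)" for k
  proof -
    have "(\<lambda>n. (- x) ^ k * (rising_coeff (\<alpha> * real k + 1) n / real n powr (\<alpha> * real k)))
        \<longlonglongrightarrow> (- x) ^ k * (1 / Gamma (\<alpha> * real k + 1))"
      using assms by (intro tendsto_mult tendsto_const rising_coeff_limit) auto
    moreover have "\<forall>\<^sub>F n in sequentially.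
        (- x) ^ k * (rising_coeff (\<alpha> * real k + 1) n / real n powr (\<alpha> * real k)) = ?a k n"
      using eventually_gt_at_top[of 0]
    proof eventually_elim
      case (elim n)
      have "(- (x / real n powr \<alpha>)) ^ k = (- x) ^ k / (real n powr \<alpha>) ^ k"
        by (simp flip: power_divide)
      then show ?case by (simp add: pw[OF elim])
    qed
    ultimately show ?thesis by (simp add: tendsto_cong)
  qed
  moreover have "\<forall>\<^sub>F (k, n) in at_top \<times>\<^sub>F sequentially.
      norm (?a k n) \<le> (1 + \<alpha> * real k) ^ m * q ^ k"
  proof -
    have "norm (?a k n) \<le> (1 + \<alpha> * real k) ^ m * q ^ k" if n: "n \<ge> max m 1" for k n
    proof -
      have "norm (?a k n) = x ^ k / real n powr (\<alpha> * real k) * rising_coeff (\<alpha> * real k + 1) n"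
        using assms n by (simp add: abs_mult power_abs rising_coeff_nonneg power_divide pw)
      also have "\<dots> \<le> x ^ k / real n powr (\<alpha> * real k) *
          ((1 + \<alpha> * real k) ^ m * exp (\<alpha> * real k * (1 - harm m)) * real n powr (\<alpha> * real k))"
        using assms n by (intro mult_left_mono rising_coeff_bound) auto
      \<comment> \<open>The scaling of \<open>\<mu>\<close> by \<open>n powr \<alpha>\<close>
        cancels the growth in \<open>n\<close>, so the majorant is independent of
        \<open>n\<close>.\<close>
      also have "\<dots> = (1 + \<alpha> * real k) ^ m * (x ^ k * exp (real k * (\<alpha> * (1 - harm m))))"
        using n by (simp add: mult_ac)
      also have "\<dots> = (1 + \<alpha> * real k) ^ m * q ^ k"
        unfolding q_def exp_of_nat_mult power_mult_distrib by simp
      finally show ?thesis .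
    qed
    then show ?thesis
      unfolding eventually_prod_filter
      by (intro exI[of _ "\<lambda>_. True"] exI[of _ "\<lambda>n. n \<ge> max m 1"] conjI eventually_ge_at_top) simp_all
  qed
  moreover have "summable (\<lambda>k. (1 + \<alpha> * real k) ^ m * q ^ k)"
    using assms m by (intro summable_poly_geometric) (auto simp: q_def)
  ultimately show ?thesis
    unfolding ml_approx_def mittag_leffler_def
    by (rule conjunct2[OF conjunct2[OF tannerys_theorem[OF _ _ _ sequentially_bot]]])
qed

lemma mittag_leffler_neg_antimono:
  assumes "0 < \<alpha>" "\<alpha> \<le> 1" "0 \<le> x" "x \<le> y"
  shows "0 \<le> mittag_leffler \<alpha> (- y)" "mittag_leffler \<alpha> (- y) \<le> mittag_leffler \<alpha> (- x)"
proof -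
  have "((\<lambda>n. y / real n powr \<alpha>) \<longlongrightarrow> 0) sequentially"
    using tendsto_mult[OF tendsto_const[of y] tendsto_neg_powr[OF _ filterlim_real_sequentially, of "- \<alpha>"]] assms(1)
    by (simp add: powr_minus_divide)
  \<comment> \<open>The facts about \<open>ml_approx\<close> require arguments below 1; the bound
    for \<open>y\<close> also covers \<open>x\<close>.\<close>
  then have small: "\<forall>\<^sub>F n in sequentially. y / real n powr \<alpha> < 1"
    by (rule order_tendstoD) simp
  have lim: "(\<lambda>n. ml_approx \<alpha> (z / real n powr \<alpha>) n) \<longlonglongrightarrow> mittag_leffler \<alpha> (- z)"
    if "0 \<le> z" for z using assms(1) that by (rule ml_approx_limit)
  show "0 \<le> mittag_leffler \<alpha> (- y)"
  proof (rule tendsto_lowerbound[OF lim])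
    show "\<forall>\<^sub>F n in sequentially. 0 \<le> ml_approx \<alpha> (y / real n powr \<alpha>) n"
      using small
    proof eventually_elim
      case (elim n)
      show ?case using assms elim by (intro ml_approx_nonneg divide_nonneg_nonneg) simp_all
    qed
  qed (use assms in auto)
  show "mittag_leffler \<alpha> (- y) \<le> mittag_leffler \<alpha> (- x)"
  proof (rule tendsto_le[OF _ lim lim])
    show "\<forall>\<^sub>F n in sequentially. ml_approx \<alpha> (y / real n powr \<alpha>) n \<le> ml_approx \<alpha> (x / real n powr \<alpha>) n"
      using small
    proof eventually_elim
      case (elim n)
      show ?case using assms elim
        by (intro ml_approx_antimono divide_right_mono divide_nonneg_nonneg) simp_all
    qed
  qed (use assms in auto)
qed

section \<open>Smooth step functions\<close>

text \<open>The polynomial factor closes the family under differentiation; \<open>p = 1\<close>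
  gives the classical smooth function that is flat at 0.\<close>

definition flat_exp :: "real poly \<Rightarrow> real \<Rightarrow> real" where
  "flat_exp p x = (if x \<le> 0 then 0 else poly p (1 / x) * exp (- (1 / x)))"

lemma poly_exp_decay: "((\<lambda>y::real. poly p y * exp (- y)) \<longlongrightarrow> 0) at_top"
proof -
  have "((\<lambda>y. \<Sum>i\<le>degree p. coeff p i * (y ^ i / exp y)) \<longlongrightarrow> (\<Sum>i\<le>degree p. coeff p i * 0)) at_top"
    by (intro tendsto_sum tendsto_mult tendsto_const tendsto_power_div_exp_0)
  then show ?thesis
    by (simp add: poly_altdef sum_distrib_right exp_minus divide_inverse mult.assoc)
qed

text \<open>For \<open>x > 0\<close> put \<open>y = 1 / x\<close>; then
  \<open>dy/dx = - y ^ 2\<close>, which produces the polynomial \<open>y ^ 2 * (p - p')\<close>. At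
  0 the exponential decay makes the difference quotient vanish.\<close>

lemma flat_exp_has_derivative:
  "(flat_exp p has_real_derivative flat_exp ([:0, 0, 1:] * (p - pderiv p)) x) (at x)"
proof -
  consider "x < 0" | "x = 0" | "x > 0" by linarith
  then show ?thesis
  proof cases
    case 1
    have "((\<lambda>_. 0) has_real_derivative 0) (at x)" by simp
    then have "(flat_exp p has_real_derivative 0) (at x)"
      by (rule has_field_derivative_transform_within_open[where S = "{..<0}"])
        (use 1 in \<open>auto simp: flat_exp_def\<close>)
    then show ?thesis using 1 by (simp add: flat_exp_def)
  next
    case 2
    have "((\<lambda>h. (flat_exp p (0 + h) - flat_exp p 0) / h) \<longlongrightarrow> 0) (at 0)"
    proof (rule filterlim_split_at)
      show "((\<lambda>h. (flat_exp p (0 + h) - flat_exp p 0) / h) \<longlongrightarrow> 0) (at_left 0)"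
        by (rule tendsto_eventually) (auto simp: flat_exp_def eventually_at_left_field intro: exI[of _ "-1"])
      \<comment> \<open>Division by \<open>h\<close> is multiplication by \<open>y = 1 / h\<close>,
        and \<open>pCons 0 p\<close> is the polynomial \<open>y * p\<close>.\<close>
      have "((\<lambda>h. poly (pCons 0 p) (1 / h) * exp (- (1 / h))) \<longlongrightarrow> 0) (at_right 0)"
        using filterlim_compose[OF poly_exp_decay filterlim_inverse_at_top_right]
        by (simp only: inverse_eq_divide)
      moreover have "\<forall>\<^sub>F h in at_right 0. poly (pCons 0 p) (1 / h) * exp (- (1 / h))
          = (flat_exp p (0 + h) - flat_exp p 0) / h"
        by (auto simp: flat_exp_def eventually_at_right_field intro: exI[of _ 1])
      ultimately show "((\<lambda>h. (flat_exp p (0 + h) - flat_exp p 0) / h) \<longlongrightarrow> 0) (at_right 0)"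
        by (rule Lim_transform_eventually)
    qed
    then show ?thesis using 2 by (simp add: DERIV_def flat_exp_def)
  next
    case 3
    have "((\<lambda>x. poly p (1 / x) * exp (- (1 / x))) has_real_derivative
        poly ([:0, 0, 1:] * (p - pderiv p)) (1 / x) * exp (- (1 / x))) (at x)"
      using 3 by (auto intro!: derivative_eq_intros DERIV_chain2[OF poly_DERIV]
          simp: divide_simps power2_eq_square algebra_simps)
    then have "(flat_exp p has_real_derivative
        poly ([:0, 0, 1:] * (p - pderiv p)) (1 / x) * exp (- (1 / x))) (at x)"
      by (rule has_field_derivative_transform_within_open[where S = "{0<..}"])
        (use 3 in \<open>auto simp: flat_exp_def\<close>)
    then show ?thesis using 3 by (simp add: flat_exp_def)
  qed
qed

lemma DERIV_rescale:
  fixes f :: "real \<Rightarrow> real"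
  assumes "\<And>x. (f has_real_derivative f' x) (at x)"
  shows "((\<lambda>x. f ((x - p) / e)) has_real_derivative f' ((x - p) / e) / e) (at x within S)"
proof -
  have "((\<lambda>x. (x - p) / e) has_real_derivative 1 / e) (at x within S)"
    by (auto intro!: derivative_eq_intros simp: divide_inverse)
  from DERIV_chain2[OF assms this] show ?thesis by simp
qed

text \<open>A class of functions closed under differentiation, so that one derivative in the class gives
  all of them.\<close>

inductive flat_smooth :: "(real \<Rightarrow> real) \<Rightarrow> bool" where
  const: "flat_smooth (\<lambda>_. c)"
| flat: "flat_smooth (flat_exp p)"
| affine: "flat_smooth f \<Longrightarrow> flat_smooth (\<lambda>x. f (u * x + v))"
| add: "flat_smooth f \<Longrightarrow> flat_smooth g \<Longrightarrow> flat_smooth (\<lambda>x. f x + g x)"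
| mult: "flat_smooth f \<Longrightarrow> flat_smooth g \<Longrightarrow> flat_smooth (\<lambda>x. f x * g x)"
| primitive: "flat_smooth f' \<Longrightarrow> (\<And>x. (f has_real_derivative f' x) (at x)) \<Longrightarrow> flat_smooth f"

lemma flat_smooth_has_derivative:
  "flat_smooth f \<Longrightarrow> \<exists>f'. flat_smooth f' \<and> (\<forall>x. (f has_real_derivative f' x) (at x))"
proof (induction rule: flat_smooth.induct)
  case (const c)
  show ?case by (intro exI[of _ "\<lambda>_. 0"]) (auto intro: flat_smooth.const)
next
  case (flat p)
  show ?case using flat_exp_has_derivative flat_smooth.flat by blast
next
  case (affine f u v)
  then obtain f' where f': "flat_smooth f'" "\<And>x. (f has_real_derivative f' x) (at x)" by blast
  have "((\<lambda>x. f (u * x + v)) has_real_derivative u * f' (u * x + v)) (at x)" for x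
  proof -
    have "((\<lambda>x. u * x + v) has_real_derivative u) (at x)"
      by (auto intro!: derivative_eq_intros)
    from DERIV_chain2[OF f'(2) this] show ?thesis by (simp add: mult.commute)
  qed
  then show ?case
    using flat_smooth.mult[OF flat_smooth.const flat_smooth.affine[OF f'(1)]] by blast
next
  case (add f g)
  then obtain f' g' where "flat_smooth f'" "flat_smooth g'"
    "\<And>x. (f has_real_derivative f' x) (at x)" "\<And>x. (g has_real_derivative g' x) (at x)" by blast
  then show ?case
    by (intro exI[of _ "\<lambda>x. f' x + g' x"]) (auto intro: flat_smooth.add DERIV_add)
next
  case (mult f g)
  then obtain f' g' where "flat_smooth f'" "flat_smooth g'"
    "\<And>x. (f has_real_derivative f' x) (at x)" "\<And>x. (g has_real_derivative g' x) (at x)" by blast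
  with mult.hyps show ?case
    by (intro exI[of _ "\<lambda>x. f' x * g x + g' x * f x"])
      (auto intro: flat_smooth.add flat_smooth.mult DERIV_mult)
qed blast

lemma flat_smooth_funpow_deriv:
  assumes "flat_smooth f"
  shows "flat_smooth ((deriv ^^ n) f)"
proof (induction n)
  case (Suc n)
  then obtain f' where "flat_smooth f'" "\<And>x. ((deriv ^^ n) f has_real_derivative f' x) (at x)"
    using flat_smooth_has_derivative by blast
  moreover from this have "deriv ((deriv ^^ n) f) = f'"
    by (auto intro: DERIV_imp_deriv)
  ultimately show ?case by simp
qed (use assms in simp)

lemma flat_smooth_differentiable:
  "flat_smooth f \<Longrightarrow> (deriv ^^ n) f field_differentiable at x"
  using flat_smooth_has_derivative[OF flat_smooth_funpow_deriv] field_differentiable_def by blast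

lemma flat_smooth_continuous: "flat_smooth f \<Longrightarrow> continuous_on S f"
  using flat_smooth_has_derivative DERIV_isCont continuous_at_imp_continuous_on by metis

text \<open>\<open>H\<close> is a primitive of a bump on the unit interval, shifted and scaled to
  rise from 0 to 1; \<open>\<rho>\<close> is the bump scaled likewise.\<close>

lemma smooth_step_exists:
  obtains H \<rho> where "flat_smooth H" "flat_smooth \<rho>" "\<And>x. (H has_real_derivative \<rho> x) (at x)"
    "\<And>x. 0 \<le> \<rho> x" "\<And>x. x \<notin> {0..1} \<Longrightarrow> \<rho> x = 0" "\<And>x. x \<le> 0 \<Longrightarrow> H x = 0" "\<And>x. 1 \<le> x \<Longrightarrow> H x = 1"
proof -
  \<comment> \<open>The flat function times its reflection about 1/2 is positive exactly between 0
    and 1. The reflection is written as \<open>- 1 * x + 1\<close> to fit the rule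
    \<open>affine\<close>.\<close>
  define b where "b x = flat_exp 1 x * flat_exp 1 (- 1 * x + 1)" for x
  have b: "flat_smooth b"
    unfolding b_def[abs_def]
    by (rule flat_smooth.mult[OF flat_smooth.flat flat_smooth.affine[OF flat_smooth.flat]])
  have b_nonneg: "0 \<le> b x" and b_pos: "0 < x \<Longrightarrow> x < 1 \<Longrightarrow> 0 < b x"
    and b_zero: "x \<le> 0 \<or> 1 \<le> x \<Longrightarrow> b x = 0" for x
    by (auto simp: b_def flat_exp_def)
  have "isCont b x" for x
    using flat_smooth_continuous[OF b, of UNIV] by (simp add: continuous_on_eq_continuous_at)
  then obtain G where G: "\<And>x. (G has_real_derivative b x) (at x)"
    using einterval_antiderivative[of "-\<infinity>" "\<infinity>" b] by (auto simp: has_real_derivative_iff_has_vector_derivative)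
  have G_left: "G x = G 0" if "x \<le> 0" for x
  proof (cases "x = 0")
    case False
    have "\<exists>z>x. z < 0 \<and> G 0 - G x = (0 - x) * b z"
      using G False that by (intro MVT2) auto
    then show ?thesis using b_zero by auto
  qed simp
  have G_right: "G x = G 1" if "1 \<le> x" for x
  proof (cases "x = 1")
    case False
    have "\<exists>z>1. z < x \<and> G x - G 1 = (x - 1) * b z"
      using G False that by (intro MVT2) auto
    then show ?thesis using b_zero by auto
  qed simp
  have "\<exists>z>0. z < 1 \<and> G 1 - G 0 = (1 - 0) * b z"
    using G by (intro MVT2) auto
  then have pos: "0 < G 1 - G 0" using b_pos by fastforce
  define k where "k = 1 / (G 1 - G 0)"
  show thesis
  proof
    show "flat_smooth (\<lambda>x. k * (G x + - G 0))" "flat_smooth (\<lambda>x. k * b x)"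
      by (intro flat_smooth.mult flat_smooth.add flat_smooth.const flat_smooth.primitive[OF b G] b)+
    show "((\<lambda>x. k * (G x + - G 0)) has_real_derivative k * b x) (at x)" for x
      by (auto intro!: derivative_eq_intros G)
    have "0 < k" using pos by (simp add: k_def)
    then show "0 \<le> k * b x" for x using b_nonneg[of x] by simp
    show "k * b x = 0" if "x \<notin> {0..1}" for x using that b_zero[of x] by auto
    show "k * (G x + - G 0) = 0" if "x \<le> 0" for x using G_left[OF that] by simp
    show "k * (G x + - G 0) = 1" if "1 \<le> x" for x using G_right[OF that] pos by (simp add: k_def)
  qed
qed

text \<open>The kernel sits on \<open>[p, p + e n]\<close> and eventually has mass 1, computed from
  its primitive \<open>H\<close>. Being one-sided, it reaches \<open>p = l\<close> but needs room to
  the right of \<open>p\<close>.\<close>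

lemma approximate_identity:
  fixes f :: "real \<Rightarrow> real"
  assumes H: "\<And>x. (H has_real_derivative \<rho> x) (at x)" and \<rho>: "continuous_on UNIV \<rho>"
    "\<And>x. 0 \<le> \<rho> x" "\<And>x. x \<notin> {0..1} \<Longrightarrow> \<rho> x = 0"
    and step: "\<And>x. x \<le> 0 \<Longrightarrow> H x = 0" "\<And>x. 1 \<le> x \<Longrightarrow> H x = 1"
    and f: "continuous_on {l..u} f" and p: "l \<le> p" "p < u"
    and e: "e \<longlonglongrightarrow> 0" "\<And>n. 0 < e n"
  shows "(\<lambda>n. integral {l..u} (\<lambda>x. f x * (\<rho> ((x - p) / e n) / e n))) \<longlonglongrightarrow> f p"
proof (rule LIMSEQ_I)
  fix r :: real assume "0 < r"
  then have r: "0 < r / 2" by simp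
  define K where "K n x = \<rho> ((x - p) / e n) / e n" for n x
  have K_nonneg: "0 \<le> K n x" for n x
    unfolding K_def using \<rho>(2) e(2)[of n] by (simp add: divide_nonneg_pos)
  have contK: "continuous_on {l..u} (K n)" for n
    unfolding K_def using e(2)[of n]
    by (intro continuous_intros continuous_on_compose2[OF \<rho>(1)]) auto
  obtain \<delta> where \<delta>: "0 < \<delta>" "\<And>x. x \<in> {l..u} \<Longrightarrow> \<bar>x - p\<bar> < \<delta> \<Longrightarrow> \<bar>f x - f p\<bar> < r / 2"
    using f[unfolded continuous_on_iff, rule_format, of p "r / 2"] p r
    by (auto simp: dist_real_def)
  \<comment> \<open>Below \<open>\<delta>\<close> the kernel sees only values near
    \<open>f p\<close>; below \<open>u - p\<close> its whole mass lies in the interval.\<close>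
  have "\<forall>\<^sub>F n in sequentially. e n < min \<delta> (u - p)"
    using e(1) by (rule order_tendstoD) (use \<delta> p in auto)
  then obtain N where N: "\<And>n. n \<ge> N \<Longrightarrow> e n < \<delta> \<and> e n < u - p"
    by (auto simp: eventually_sequentially)
  have "norm (integral {l..u} (\<lambda>x. f x * K n x) - f p) < r" if "n \<ge> N" for n
  proof -
    have "((\<lambda>x. H ((x - p) / e n)) has_real_derivative K n x) (at x within {l..u})" for x
      unfolding K_def using H by (rule DERIV_rescale)
    then have "(K n has_integral H ((u - p) / e n) - H ((l - p) / e n)) {l..u}"
      using p by (intro fundamental_theorem_of_calculus)
        (auto simp: has_real_derivative_iff_has_vector_derivative)
    moreover have "H ((u - p) / e n) = 1" "H ((l - p) / e n) = 0"
      using N[OF that] e(2)[of n] p by (auto intro!: step simp: divide_simps)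
    ultimately have K1: "(K n has_integral 1) {l..u}" by simp
    have int: "(\<lambda>x. (f x - f p) * K n x) integrable_on {l..u}"
      by (intro integrable_continuous_real continuous_intros f contK)
    have "((\<lambda>x. (f x - f p) * K n x + f p * K n x) has_integral
        integral {l..u} (\<lambda>x. (f x - f p) * K n x) + f p * 1) {l..u}"
      by (intro has_integral_add has_integral_mult_right K1 integrable_integral int)
    then have "integral {l..u} (\<lambda>x. f x * K n x) - f p = integral {l..u} (\<lambda>x. (f x - f p) * K n x)"
      by (simp add: algebra_simps integral_unique)
    also have "norm \<dots> \<le> integral {l..u} (\<lambda>x. r / 2 * K n x)"
    proof (rule integral_norm_bound_integral[OF int])
      show "(\<lambda>x. r / 2 * K n x) integrable_on {l..u}"
        using K1 by (intro integrable_on_mult_right) blast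
      fix x assume x: "x \<in> {l..u}"
      show "norm ((f x - f p) * K n x) \<le> r / 2 * K n x"
      proof (cases "(x - p) / e n \<in> {0..1}")
        case True
        then have "\<bar>x - p\<bar> < \<delta>" using N[OF that] e(2)[of n] by (auto simp: divide_simps split: if_splits)
        then show ?thesis
          using mult_right_mono[OF less_imp_le[OF \<delta>(2)[OF x]] K_nonneg[of n x]] K_nonneg[of n x]
          by (simp add: abs_mult)
      next
        case False
        then show ?thesis using \<rho>(3) by (simp add: K_def)
      qed
    qed
    also have "\<dots> = r / 2" using integral_unique[OF K1] by simp
    finally show ?thesis using \<open>0 < r\<close> by simp
  qed
  then show "\<exists>N. \<forall>n\<ge>N. norm (integral {l..u} (\<lambda>x. f x * (\<rho> ((x - p) / e n) / e n)) - f p) < r"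
    unfolding K_def by blast
qed

section \<open>Weak derivatives\<close>

text \<open>Passes from the Lebesgue integrals in \<open>has_weak_derivative\<close> to gauge
  integrals over a compact interval outside which the integrand vanishes.\<close>

lemma set_lebesgue_integral_eq_integral_support:
  fixes h :: "real \<Rightarrow> real"
  assumes "S \<subseteq> T" "\<And>x. x \<notin> S \<Longrightarrow> h x = 0" "h absolutely_integrable_on S"
  shows "(LINT x:T|lebesgue. h x) = integral S h"
proof -
  have "(LINT x:T|lebesgue. h x) = (LINT x:S|lebesgue. h x)"
    unfolding set_lebesgue_integral_def
    by (rule arg_cong[where f = "lebesgue_integral lebesgue"])
      (use assms(1,2) in \<open>auto simp: indicator_def fun_eq_iff\<close>)
  then show ?thesis using set_lebesgue_integral_eq_integral(2)[OF assms(3)] by simp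
qed

text \<open>Tested against smoothed indicators \<open>\<phi> n\<close> of \<open>{c<..d}\<close>, whose derivatives approximate the difference
  of the Dirac masses at \<open>c\<close> and \<open>d\<close>.\<close>

lemma weak_derivative_integral:
  assumes fg: "has_weak_derivative f g a b" and contf: "continuous_on {a<..<b} f"
    and cd: "a < c" "c \<le> d" "d < b"
  shows "integral {c..d} g = f d - f c"
proof -
  obtain H \<rho> where H: "flat_smooth H" "flat_smooth \<rho>" "\<And>x. (H has_real_derivative \<rho> x) (at x)"
    "\<And>x. 0 \<le> \<rho> x" "\<And>x. x \<notin> {0..1} \<Longrightarrow> \<rho> x = 0" "\<And>x. x \<le> 0 \<Longrightarrow> H x = 0" "\<And>x. 1 \<le> x \<Longrightarrow> H x = 1"
    using smooth_step_exists by metis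
  have H01: "0 \<le> H x" "H x \<le> 1" for x
  proof -
    have mono: "H y \<le> H z" if "y \<le> z" for y z
      using that H(3,4) DERIV_nonneg_imp_nondecreasing by blast
    show "0 \<le> H x" "H x \<le> 1"
      using mono[of "min x 0" x] mono[of x "max x 1"] H(6)[of "min x 0"] H(7)[of "max x 1"] by auto
  qed
  \<comment> \<open>The step at \<open>d\<close> rises on \<open>[d, d + e n]\<close>; with
    \<open>e n \<le> r\<close> the test functions vanish outside a fixed compact subset of the open
    interval.\<close>
  define r where "r = (b - d) / 2"
  have r: "0 < r" "d + r < b" using cd by (auto simp: r_def field_simps)
  define e where "e n = r / real (Suc n)" for n
  have e: "e \<longlonglongrightarrow> 0" "0 < e n" "e n \<le> r" for n
  proof -
    show "e \<longlonglongrightarrow> 0" unfolding e_def using LIMSEQ_Suc[OF lim_const_over_n] by blast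
    show "0 < e n" "e n \<le> r" using r by (auto simp: e_def field_simps)
  qed
  let ?S = "{c..d + r}"
  have S: "?S \<subseteq> {a<..<b}" using cd r by auto
  define \<phi> where "\<phi> n x = H ((x - c) / e n) - H ((x - d) / e n)" for n x
  define K where "K p n x = \<rho> ((x - p) / e n) / e n" for p n x
  have K: "continuous_on ?S (K p n)" for p n
    unfolding K_def using e(2)[of n]
    by (intro continuous_intros continuous_on_compose2[OF flat_smooth_continuous[OF H(2)]]) auto
  have \<phi>_smooth: "flat_smooth (\<phi> n)" for n
  proof -
    have "(x - p) / e n = 1 / e n * x + - p / e n" for x p
      by (simp add: diff_divide_distrib)
    then have eq: "\<phi> n = (\<lambda>x. H (1 / e n * x + - c / e n) + - 1 * H (1 / e n * x + - d / e n))"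
      by (simp add: \<phi>_def fun_eq_iff)
    show ?thesis unfolding eq
      by (rule flat_smooth.add[OF flat_smooth.affine flat_smooth.mult[OF flat_smooth.const flat_smooth.affine]])
        (rule H(1))+
  qed
  have deriv_\<phi>: "deriv (\<phi> n) x = K c n x - K d n x" for n x
    unfolding \<phi>_def[abs_def] K_def
    by (intro DERIV_imp_deriv DERIV_diff DERIV_rescale H)
  have \<phi>_zero: "\<phi> n x = 0" if "x \<notin> ?S" for n x
  proof (cases "x < c")
    case True
    then show ?thesis using H(6) e(2)[of n] cd by (simp add: \<phi>_def divide_nonpos_pos)
  next
    case False
    then have "e n \<le> x - c" "e n \<le> x - d" using that e(3)[of n] cd by auto
    then show ?thesis using H(7) e(2)[of n] by (simp add: \<phi>_def)
  qed
  have K_zero: "K p n x = 0" if "x \<notin> ?S" "p \<in> {c..d}" for p n x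
  proof -
    have "(x - p) / e n \<notin> {0..1}"
      using that e(2,3)[of n] by (auto simp: divide_simps split: if_splits)
    then show ?thesis using H(5) by (simp add: K_def)
  qed
  have "\<phi> n \<in> test_functions a b" for n
    unfolding test_functions_def
    using flat_smooth_differentiable[OF \<phi>_smooth] S \<phi>_zero by (auto intro!: exI[of _ ?S])
  then have eq: "(LINT x:{a<..<b}|lebesgue. f x * deriv (\<phi> n) x) = - (LINT x:{a<..<b}|lebesgue. g x * \<phi> n x)" for n
    using fg by (auto simp: has_weak_derivative_def)
  have contf': "continuous_on ?S f" using contf S by (rule continuous_on_subset)
  have gS: "g absolutely_integrable_on ?S"
    using fg S by (auto simp: has_weak_derivative_def locally_integrable_def)
  have "(LINT x:{a<..<b}|lebesgue. f x * deriv (\<phi> n) x)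
      = integral ?S (\<lambda>x. f x * K c n x) - integral ?S (\<lambda>x. f x * K d n x)" for n
  proof -
    have "(LINT x:{a<..<b}|lebesgue. f x * deriv (\<phi> n) x) = integral ?S (\<lambda>x. f x * deriv (\<phi> n) x)"
      using S by (rule set_lebesgue_integral_eq_integral_support)
        (use cd in \<open>auto simp: deriv_\<phi> K_zero intro!: absolutely_integrable_continuous_real continuous_intros contf' K\<close>)
    also have "\<dots> = integral ?S (\<lambda>x. f x * K c n x) - integral ?S (\<lambda>x. f x * K d n x)"
      unfolding deriv_\<phi> right_diff_distrib
      by (intro integral_diff integrable_continuous_real continuous_intros contf' K)
    finally show ?thesis .
  qed
  moreover have "(\<lambda>n. integral ?S (\<lambda>x. f x * K p n x)) \<longlonglongrightarrow> f p" if "p \<in> {c..d}" for p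
    unfolding K_def using that r(1)
    by (intro approximate_identity[OF H(3) flat_smooth_continuous[OF H(2)] H(4-7) contf'] e) auto
  ultimately have lim1: "(\<lambda>n. LINT x:{a<..<b}|lebesgue. f x * deriv (\<phi> n) x) \<longlonglongrightarrow> f c - f d"
    using cd by (auto intro!: tendsto_diff)
  have g\<phi>: "(\<lambda>x. g x * \<phi> n x) absolutely_integrable_on ?S" for n
  proof -
    have c\<phi>: "continuous_on ?S (\<phi> n)" using \<phi>_smooth by (rule flat_smooth_continuous)
    have "(\<lambda>x. \<phi> n x * g x) absolutely_integrable_on ?S"
      using gS c\<phi> by (intro absolutely_integrable_bounded_measurable_product_real
          continuous_imp_measurable_on_sets_lebesgue compact_imp_bounded compact_continuous_image) auto
    then show ?thesis by (simp add: mult.commute)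
  qed
  \<comment> \<open>The majorant is \<open>\<bar>g\<bar>\<close>, as
    \<open>\<bar>\<phi> n\<bar> \<le> 1\<close>. The limit is half-open because
    \<open>H 0 = 0\<close>: at each jump the step still has its left value.\<close>
  have "(\<lambda>n. integral ?S (\<lambda>x. g x * \<phi> n x)) \<longlonglongrightarrow> integral ?S (\<lambda>x. if x \<in> {c<..d} then g x else 0)"
  proof (rule dominated_convergence(2))
    show "(\<lambda>x. g x * \<phi> n x) integrable_on ?S" for n
      using g\<phi> by (rule set_lebesgue_integral_eq_integral(1))
    show "(\<lambda>x. norm (g x)) integrable_on ?S"
      using gS by (simp add: absolutely_integrable_on_def)
    have "\<bar>\<phi> n x\<bar> \<le> 1" for n x
      using H01[of "(x - c) / e n"] H01[of "(x - d) / e n"] by (auto simp: \<phi>_def)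
    then show "norm (g x * \<phi> n x) \<le> norm (g x)" for n x
      by (simp add: abs_mult mult_left_le)
    fix x assume x: "x \<in> ?S"
    have ev: "\<forall>\<^sub>F n in sequentially. H ((x - p) / e n) = (if p < x then 1 else 0)" for p
    proof (cases "p < x")
      case True
      then have "\<forall>\<^sub>F n in sequentially. e n < x - p"
        using e(1) by (intro order_tendstoD) auto
      then show ?thesis
        by eventually_elim (use True H(7) e(2) in auto)
    qed (use H(6) e(2) in \<open>auto simp: divide_nonpos_pos\<close>)
    have "\<forall>\<^sub>F n in sequentially. g x * \<phi> n x = (if x \<in> {c<..d} then g x else 0)"
      using ev[of c] ev[of d] by eventually_elim (use cd in \<open>auto simp: \<phi>_def\<close>)
    then show "(\<lambda>n. g x * \<phi> n x) \<longlonglongrightarrow> (if x \<in> {c<..d} then g x else 0)"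
      by (rule tendsto_eventually)
  qed
  moreover have "(LINT x:{a<..<b}|lebesgue. g x * \<phi> n x) = integral ?S (\<lambda>x. g x * \<phi> n x)" for n
    using S by (rule set_lebesgue_integral_eq_integral_support) (auto simp: \<phi>_zero g\<phi>)
  moreover have "integral ?S (\<lambda>x. if x \<in> {c<..d} then g x else 0) = integral {c..d} g"
  proof -
    have "integral ?S (\<lambda>x. if x \<in> {c<..d} then g x else 0) = integral ?S (\<lambda>x. if x \<in> {c..d} then g x else 0)"
      by (rule integral_spike[of "{c}"]) auto
    also have "\<dots> = integral {c..d} g"
      using r by (subst Henstock_Kurzweil_Integration.integral_restrict_Int) (simp add: min_def)
    finally show ?thesis .
  qed
  ultimately have "(\<lambda>n. - (LINT x:{a<..<b}|lebesgue. g x * \<phi> n x)) \<longlonglongrightarrow> - integral {c..d} g"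
    by (intro tendsto_minus) simp
  then have "f c - f d = - integral {c..d} g"
    using lim1 unfolding eq by (rule LIMSEQ_unique[rotated])
  then show ?thesis by simp
qed

text \<open>On a bounded interval \<open>\<bar>g\<bar> \<le> 1 + g ^ 2\<close> is an integrable
  bound.\<close>

lemma square_integrable_imp_absolutely_integrable:
  assumes "square_integrable a b g"
  shows "g absolutely_integrable_on {a<..<b}"
proof (rule measurable_bounded_by_integrable_imp_absolutely_integrable)
  show "g \<in> borel_measurable (lebesgue_on {a<..<b})"
    using assms unfolding square_integrable_def set_borel_measurable_def
    by (subst borel_measurable_restrict_space_iff) auto
  have "(\<lambda>x. (g x)\<^sup>2) integrable_on {a<..<b}"
    using assms unfolding square_integrable_def by (auto intro: set_lebesgue_integral_eq_integral(1))
  moreover have "(\<lambda>x. 1 :: real) integrable_on {a<..<b}"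
    using integrable_on_const[of "{a<..<b}" "1 :: real"] by simp
  ultimately show "(\<lambda>x. 1 + (g x)\<^sup>2) integrable_on {a<..<b}"
    by (rule integrable_add[rotated])
  show "norm (g x) \<le> 1 + (g x)\<^sup>2" for x
    using sum_squares_bound[of 1 "\<bar>g x\<bar>"] by (simp add: power2_eq_square)
qed auto

text \<open>Lebesgue differentiation: almost everywhere \<open>w x\<close> is the limit of the
  averages over \<open>[x, x + h]\<close>, which are all zero.\<close>

lemma negligible_nonzero_if_integral_zero:
  fixes w :: "real \<Rightarrow> real"
  assumes w: "w integrable_on {c..d}"
    and zero: "\<And>u v. c \<le> u \<Longrightarrow> u \<le> v \<Longrightarrow> v \<le> d \<Longrightarrow> integral {u..v} w = 0"
  shows "negligible {x \<in> {c..d}. w x \<noteq> 0}"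
proof -
  \<comment> \<open>Extension by zero supplies the integrability on every box that the
    differentiation theorem asks for.\<close>
  let ?w = "\<lambda>x. if x \<in> {c..d} then w x else 0"
  have "?w integrable_on cbox u v" for u v
  proof -
    have "w integrable_on {max c u..min d v}"
      using w by (rule integrable_on_subinterval) auto
    then show ?thesis
      by (simp only: cbox_interval Henstock_Kurzweil_Integration.integrable_restrict_Int Int_atLeastAtMost)
  qed
  then obtain N where N: "negligible N" "\<And>x e. x \<notin> N \<Longrightarrow> 0 < e \<Longrightarrow>
      \<exists>d>0. \<forall>h. 0 < h \<and> h < d \<longrightarrow> norm (integral (cbox x (x + h *\<^sub>R One)) ?w /\<^sub>R h ^ DIM(real) - ?w x) < e"
    using integrable_ccontinuous_explicit by blast
  have int: "integral {u..v} ?w = 0" for u v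
  proof -
    have "integral {u..v} ?w = integral {max c u..min d v} w"
      by (simp only: Henstock_Kurzweil_Integration.integral_restrict_Int Int_atLeastAtMost)
    also have "\<dots> = 0"
      by (cases "max c u \<le> min d v") (auto intro: zero)
    finally show ?thesis .
  qed
  have "w x = 0" if x: "x \<notin> N" "x \<in> {c..d}" for x
  proof (rule ccontr)
    assume "w x \<noteq> 0"
    then obtain \<delta> where "0 < \<delta>" and \<delta>: "\<And>h. 0 < h \<Longrightarrow> h < \<delta> \<Longrightarrow>
        norm (integral (cbox x (x + h *\<^sub>R One)) ?w /\<^sub>R h ^ DIM(real) - ?w x) < \<bar>w x\<bar>"
      using N(2)[OF x(1), of "\<bar>w x\<bar>"] by fastforce
    from \<delta>[of "\<delta> / 2"] \<open>0 < \<delta>\<close> x(2) show False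
      unfolding cbox_interval int by simp
  qed
  then show ?thesis by (intro negligible_subset[OF N(1)]) auto
qed

lemma has_weak_derivative_integrable:
  assumes "has_weak_derivative f g a b" "a < u" "v < b"
  shows "g absolutely_integrable_on {u..v}"
proof -
  have "{u..v} \<subseteq> {a<..<b}" using assms(2,3) by auto
  then show ?thesis
    using assms(1) unfolding has_weak_derivative_def locally_integrable_def by blast
qed

text \<open>Both have the same integrals over compact subintervals. Integrability is only local, so
  the argument runs near each point and uses that locally negligible sets are negligible.\<close>

lemma weak_derivative_unique_ae:
  assumes g: "has_weak_derivative f g a b" and h: "has_weak_derivative f h a b"
    and contf: "continuous_on {a<..<b} f"
  shows "negligible {x \<in> {a<..<b}. g x \<noteq> h x}"
proof (subst locally_negligible_alt, intro ballI)
  let ?S = "{x \<in> {a<..<b}. g x \<noteq> h x}"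
  fix x assume x: "x \<in> ?S"
  define c d where "c = (a + x) / 2" and "d = (x + b) / 2"
  have cd: "a < c" "c < x" "x < d" "d < b" using x by (auto simp: c_def d_def)
  have int: "g integrable_on {u..v}" "h integrable_on {u..v}" if "c \<le> u" "v \<le> d" for u v
    using g h cd that
    by (auto intro!: set_lebesgue_integral_eq_integral(1) has_weak_derivative_integrable)
  have "negligible {x \<in> {c..d}. g x - h x \<noteq> 0}"
  proof (rule negligible_nonzero_if_integral_zero)
    show "(\<lambda>x. g x - h x) integrable_on {c..d}"
      by (intro integrable_diff int) auto
    fix u v assume uv: "c \<le> u" "u \<le> v" "v \<le> d"
    then have "integral {u..v} g = integral {u..v} h"
      using weak_derivative_integral[OF g contf, of u v] weak_derivative_integral[OF h contf, of u v] cd by simp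
    then show "integral {u..v} (\<lambda>x. g x - h x) = 0"
      using int[OF uv(1,3)] by (simp add: integral_diff)
  qed
  then have "negligible (?S \<inter> {c<..<d})" by (rule negligible_subset) auto
  then show "\<exists>U. openin (top_of_set ?S) U \<and> x \<in> U \<and> negligible U"
    using x cd by (intro exI[of _ "?S \<inter> {c<..<d}"]) (auto simp: openin_open_Int)
qed

text \<open>A weak derivative is a priori only locally integrable; integrability up to the endpoints comes
  from the square integrable representative.\<close>

lemma H1_weak_derivative:
  assumes "a < b" "f \<in> H1 a b" "continuous_on {a..b} f" "has_weak_derivative f g a b"
  shows "g absolutely_integrable_on {a..b}"
    and "a \<le> c \<Longrightarrow> c \<le> d \<Longrightarrow> d \<le> b \<Longrightarrow> integral {c..d} g = f d - f c"
proof -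
  have contf: "continuous_on {a<..<b} f" using assms(3) by (rule continuous_on_subset) auto
  obtain h where h: "has_weak_derivative f h a b" "square_integrable a b h"
    using assms(2) by (auto simp: H1_def)
  have "g absolutely_integrable_on {a<..<b}"
    by (rule absolutely_integrable_spike[OF square_integrable_imp_absolutely_integrable[OF h(2)]
          weak_derivative_unique_ae[OF assms(4) h(1) contf]]) auto
  then show g: "g absolutely_integrable_on {a..b}"
    using absolutely_integrable_on_open_interval[where f = g and a = a and b = b] by simp
  have int: "g integrable_on {a..b}" using g by (rule set_lebesgue_integral_eq_integral(1))
  \<comment> \<open>\<open>F\<close> is constant on the open interval; continuity carries this to
    the endpoints, which admits \<open>c = a\<close> and \<open>d = b\<close>.\<close>
  define F where "F x = f x - integral {a..x} g" for x
  have F_diff: "F v - F u = f v - f u - integral {u..v} g" if "a \<le> u" "u \<le> v" "v \<le> b" for u v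
  proof -
    have "g integrable_on {a..v}" using int by (rule integrable_on_subinterval) (use that in auto)
    with that have "integral {a..u} g + integral {u..v} g = integral {a..v} g"
      by (intro Henstock_Kurzweil_Integration.integral_combine)
    then show ?thesis by (simp add: F_def)
  qed
  have contF: "continuous_on {a..b} F"
    unfolding F_def[abs_def] by (intro continuous_intros assms(3) indefinite_integral_continuous_1 int)
  let ?m = "(a + b) / 2"
  have "F x = F ?m" if x: "x \<in> {a<..<b}" for x
  proof -
    have "F v = F u" if "a < u" "u \<le> v" "v < b" for u v
      using F_diff[of u v] weak_derivative_integral[OF assms(4) contf that] that by simp
    from this[of x ?m] this[of ?m x] x assms(1) show ?thesis
      by (cases "x \<le> ?m") auto
  qed
  moreover have cl: "closure {a<..<b} = {a..b}"
    using assms(1) by (rule closure_greaterThanLessThan)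
  ultimately have const: "F x = F ?m" if "x \<in> {a..b}" for x
    using continuous_constant_on_closure[of "{a<..<b}" F "F ?m" x] contF that by (simp only: cl)
  show "integral {c..d} g = f d - f c" if "a \<le> c" "c \<le> d" "d \<le> b"
    using F_diff[OF that] const[of c] const[of d] that by simp
qed

section \<open>The estimate at a minimum\<close>

theorem lemma2p2:
  fixes a b \<alpha> t0 :: real and B f :: "real \<Rightarrow> real"
  assumes "a < b" and "0 < \<alpha>" and "\<alpha> < 1"
    and "\<And>x. x \<in> {0..1} \<Longrightarrow> 0 < B x" and "B 0 = 1" and "B 1 = 1"
    and "f \<in> H1 a b" and "continuous_on {a..b} f"
    and "t0 \<in> {a..b}" and "\<And>t. t \<in> {a..b} \<Longrightarrow> f t0 \<le> f t"
  shows "ABC_deriv B \<alpha> a b f t0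
           \<le> B \<alpha> / (1 - \<alpha>) * mittag_leffler \<alpha> (- (\<alpha> / (1 - \<alpha>)) * (t0 - a) powr \<alpha>) * (f t0 - f a)
       \<and> B \<alpha> / (1 - \<alpha>) * mittag_leffler \<alpha> (- (\<alpha> / (1 - \<alpha>)) * (t0 - a) powr \<alpha>) * (f t0 - f a) \<le> 0"
proof -
  define k where "k s = mittag_leffler \<alpha> (- (\<alpha> / (1 - \<alpha>)) * (t0 - s) powr \<alpha>)" for s
  define g where "g = weak_deriv a b f"
  \<comment> \<open>The choice operator returns some weak derivative, not necessarily the square
    integrable one; \<open>H1_weak_derivative\<close> covers any of them.\<close>
  have g: "has_weak_derivative f g a b"
    using someI_ex[of "\<lambda>g. has_weak_derivative f g a b"] assms(7)
    unfolding g_def weak_deriv_def H1_def by blast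
  note gint = H1_weak_derivative[OF assms(1,7,8) g]
  have k: "0 \<le> k s" "k s \<le> k t" if "s \<le> t" "t \<le> t0" for s t
  proof -
    have "\<alpha> / (1 - \<alpha>) * (t0 - t) powr \<alpha> \<le> \<alpha> / (1 - \<alpha>) * (t0 - s) powr \<alpha>"
      using assms(2,3) that by (intro mult_left_mono powr_mono2) auto
    moreover have "0 \<le> \<alpha> / (1 - \<alpha>) * (t0 - t) powr \<alpha>" using assms(2,3) by simp
    ultimately show "0 \<le> k s" "k s \<le> k t"
      unfolding k_def mult_minus_left using assms(2,3)
      by (auto intro: mittag_leffler_neg_antimono)
  qed
  have t0: "a \<le> t0" "t0 \<le> b" using assms(9) by auto
  have gabs: "g absolutely_integrable_on {a..t0}"
    using gint(1) by (rule set_integrable_subset) (use t0 in auto)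
  \<comment> \<open>Monotonicity gives measurability of the kernel; with the bound by
    \<open>k t0\<close> the product \<open>k * g\<close> is absolutely integrable, so its Lebesgue
    and gauge integrals agree.\<close>
  have "mono_on {a..t0} k" by (rule mono_onI) (use k in auto)
  then have "k \<in> borel_measurable (restrict_space borel {a..t0})"
    by (rule borel_measurable_mono_on_fnc)
  then have "k \<in> borel_measurable (lebesgue_on {a..t0})"
    by (simp add: borel_measurable_restrict_space_iff measurable_completion)
  moreover have "k ` {a..t0} \<subseteq> {0..k t0}" using k by auto
  then have "bounded (k ` {a..t0})" by (rule bounded_subset[rotated]) simp
  ultimately have kg: "(\<lambda>s. k s * g s) absolutely_integrable_on {a..t0}"
    using gabs by (intro absolutely_integrable_bounded_measurable_product_real) auto
  obtain c where c: "c \<in> {a..t0}"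
    "integral {a..t0} (\<lambda>s. k s * g s) = k a * integral {a..c} g + k t0 * integral {c..t0} g"
    using second_mean_value_theorem[OF set_lebesgue_integral_eq_integral(1)[OF gabs] t0(1), of k] k by blast
  have "(LINT s:{a..t0}|lebesgue. k s * g s) = k a * (f c - f a) + k t0 * (f t0 - f c)"
    using set_lebesgue_integral_eq_integral(2)[OF kg] c gint(2)[of a c] gint(2)[of c t0] t0 by simp
  also have "k t0 * (f t0 - f c) \<le> k a * (f t0 - f c)"
    using k(2)[of a t0] t0 c(1) assms(10)[of c] by (intro mult_right_mono_neg) auto
  also have "k a * (f c - f a) + k a * (f t0 - f c) = k a * (f t0 - f a)"
    by (simp add: algebra_simps)
  finally have le: "(LINT s:{a..t0}|lebesgue. k s * g s) \<le> k a * (f t0 - f a)" by simp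
  have B: "0 \<le> B \<alpha> / (1 - \<alpha>)" using assms(2,3) assms(4)[of \<alpha>] by simp
  have "k a * (f t0 - f a) \<le> 0"
    using k(1)[of a t0] t0 assms(10)[of a] by (intro mult_nonneg_nonpos) auto
  from mult_left_mono[OF le B] mult_nonneg_nonpos[OF B this] show ?thesis
    unfolding ABC_deriv_def k_def[symmetric] g_def[symmetric] mult.assoc by (rule conjI)
qed

end
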